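(* Let $p$ and $q$ be positive coprime integers with $p\geqslant 59\,q$ and $p>9q^3$, and let $$Q_{pq}(t)=t^{10}+(2q^2+p^2)(3q^2-2p^2)\,t^8+(q^8+10p^2q^6+4p^4q^4-14p^6q^2+p^8)\,t^6-p^2q^2(q^8-14p^2q^6+4p^4q^4+10p^6q^2+p^8)\,t^4-p^6q^6(q^2+2p^2)(3p^2-2q^2)\,t^2-q^{10}p^{10}.$$ Then there is no integer $t$ with $Q_{pq}(t)=0$ providing a perfect cuboid, i.e. no integer $t$ with $Q_{pq}(t)=0$, $t>p^2$, $t>pq$, $t>q^2$ and $(p^2+t)(pq+t)>2t^2$.
   Context: The equation $Q_{pq}(t)=0$ is the reduced cuboid characteristic equation arising in the case of the second cuboid conjecture. A triple of integers $p,q,t$ with $p\neq q$ positive and coprime and $Q_{pq}(t)=0$ is said to provide a perfect cuboid (a rectangular parallelepiped with integer edges, face diagonals and space diagonal) if and only if $t>p^2$, $t>pq$, $t>q^2$ and $(p^2+t)(pq+t)>2t^2$; this equivalence is taken from earlier work and is used here as the definition. *)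

theory Defs
  imports Main
begin

text \<open>The left-hand side of the reduced cuboid characteristic equation.\<close>

definition Q :: "int \<Rightarrow> int \<Rightarrow> int \<Rightarrow> int" where
  "Q p q t =
     t^10
     + (2*q^2 + p^2) * (3*q^2 - 2*p^2) * t^8
     + (q^8 + 10*p^2*q^6 + 4*p^4*q^4 - 14*p^6*q^2 + p^8) * t^6
     - p^2*q^2 * (q^8 - 14*p^2*q^6 + 4*p^4*q^4 + 10*p^6*q^2 + p^8) * t^4
     - p^6*q^6 * (q^2 + 2*p^2) * (3*p^2 - 2*q^2) * t^2
     - q^10 * p^10"

text \<open>
  A triple of integers with \<open>p \<noteq> q\<close> positive and coprime and \<open>Q p q t = 0\<close> provides a perfect
  cuboid if and only if the inequalities hold. This equivalence comes from earlier work on the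
  second cuboid conjecture and is taken as the definition here.
\<close>

definition provides_perfect_cuboid :: "int \<Rightarrow> int \<Rightarrow> int \<Rightarrow> bool" where
  "provides_perfect_cuboid p q t \<longleftrightarrow>
     p > 0 \<and> q > 0 \<and> p \<noteq> q \<and> coprime p q \<and> Q p q t = 0 \<and>
     t > p^2 \<and> t > p*q \<and> t > q^2 \<and> (p^2 + t) * (p*q + t) > 2 * t^2"

end

(*
Put a = p^2 + 2 p q - 2 q^2. As q/p tends to 0, the only root of Q p q beyond p^2 is
t = a + 5 q^3 / p + ..., so p > 9 q^3 squeezes it strictly between the integers a and a + 1.
The upper half is not even a statement about Q: for t >= a + 1 the inequality
(p^2 + t) (p q + t) > 2 t^2 fails. For p^2 < t <= a, view Q as a quintic in the variable
x = t^2 - p^4. Its coefficients of order at least 2 are nonnegative, so on [0, a^2 - p^4] it lies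
below its chord, and it is negative at both ends.
*)
theory Submission
  imports Defs
begin

lemma quintic_neg_between:
  fixes x d :: "'a::linordered_idom"
  assumes x: "0 \<le> x" "x \<le> d" and "0 < d"
    and c: "c0 < 0" "0 \<le> c2" "0 \<le> c3" "0 \<le> c4" "0 \<le> c5"
    and end_neg: "c0 + c1*d + c2*d^2 + c3*d^3 + c4*d^4 + c5*d^5 < 0"
  shows "c0 + c1*x + c2*x^2 + c3*x^3 + c4*x^4 + c5*x^5 < 0"
proof -
  define P where "P y = c0 + c1*y + c2*y^2 + c3*y^3 + c4*y^4 + c5*y^5" for y
  have pow: "c * (d * x^Suc k) \<le> c * (x * d^Suc k)" if "0 \<le> c" for c :: 'a and k
  proof -
    have "x^k \<le> d^k"
      using x by (intro power_mono)
    then have "(d * x) * x^k \<le> (d * x) * d^k"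
      using x \<open>0 < d\<close> by (intro mult_left_mono) auto
    then show ?thesis
      using that by (intro mult_left_mono) (auto simp: algebra_simps)
  qed
  have "d * P x = d * c0 + c1 * (d*x) + c2 * (d * x^2) + c3 * (d * x^3) + c4 * (d * x^4) + c5 * (d * x^5)"
    unfolding P_def by (simp add: algebra_simps)
  also have "\<dots> \<le> d * c0 + c1 * (d*x) + c2 * (x * d^2) + c3 * (x * d^3) + c4 * (x * d^4) + c5 * (x * d^5)"
    using pow[OF c(2), of 1] pow[OF c(3), of 2] pow[OF c(4), of 3] pow[OF c(5), of 4]
    by (simp add: eval_nat_numeral)
  also have "\<dots> = (d - x) * c0 + x * P d"
    unfolding P_def by (simp add: algebra_simps)
  also have "\<dots> < 0"
  proof (cases "x = d")
    case True
    then show ?thesis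
      using end_neg \<open>0 < d\<close> by (simp add: P_def mult_pos_neg)
  next
    case False
    then have "(d - x) * c0 < 0"
      using x c(1) by (intro mult_pos_neg) auto
    moreover have "x * P d \<le> 0"
      using end_neg x(1) by (intro mult_nonneg_nonpos) (auto simp: P_def)
    ultimately show ?thesis
      by simp
  qed
  finally show ?thesis
    using \<open>0 < d\<close> by (simp add: P_def mult_less_0_iff)
qed

text \<open>Taylor expansion of the quintic in t^2 about t^2 = p^4. The leading coefficient
  \<open>1\<close> stays explicit so that the right-hand side matches the pattern
  \<open>c5*x^5\<close>.\<close>

lemma Q_expansion:
  "Q p q t = (16*p^12*q^8 - 16*p^18*q^2)
     + (32*p^8*q^8 + 16*p^10*q^6 + 16*p^12*q^4 - 48*p^14*q^2) * (t^2 - p^4)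
     + (p^12 - 49*p^10*q^2 + 38*p^8*q^4 + 26*p^6*q^6 + 17*p^4*q^8 - p^2*q^10) * (t^2 - p^4)^2
     + (3*p^8 - 18*p^6*q^2 + 28*p^4*q^4 + 10*p^2*q^6 + q^8) * (t^2 - p^4)^3
     + (3*p^4 - p^2*q^2 + 6*q^4) * (t^2 - p^4)^4
     + 1 * (t^2 - p^4)^5"
  unfolding Q_def by algebra

lemma Q_neg_at_approximate_root:
  assumes "0 < q" "59 * q \<le> p"
  shows "Q p q (p^2 + 2*p*q - 2*q^2) < 0"
proof -
  define r where "r = p - 59 * q"
  have "Q p q (p^2 + 2*p*q - 2*q^2) = - 16 * q^4 *
   (5*p^16 + 50*p^15*q + 138*p^14*q^2 - 134*p^13*q^3 - 1020*p^12*q^4 - 60*p^11*q^5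
    + 3596*p^10*q^6 + 128*p^9*q^7 - 8021*p^8*q^8 + 2878*p^7*q^9 + 9914*p^6*q^10 - 9410*p^5*q^11
    - 2013*p^4*q^12 + 7616*p^3*q^13 - 4935*p^2*q^14 + 1432*p*q^15 - 164*q^16)"
    unfolding Q_def by algebra
  \<comment> \<open>The shift p = r + 59 q makes every coefficient positive, so r \<ge> 0 settles
    the sign; the pure power of \<open>q\<close> makes it strict.\<close>
  also have "\<dots> = - 16 * q^4 *
   (5*r^16 + 4770*r^15*q + 2132988*r^14*q^2 + 593450304*r^13*q^3 + 114983967950*r^12*q^4
    + 16451236070706*r^11*q^5 + 1797920213173248*r^10*q^6 + 153102852840167032*r^9*q^7
    + 10266613064806648399*r^8*q^8 + 543934442431527233484*r^7*q^9
    + 22693266079293338481056*r^6*q^10 + 737714828936854318984112*r^5*q^11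
    + 18318536384665718087609877*r^4*q^12 + 335893412952176261184256800*r^3*q^13
    + 4289131686661433411402830275*r^2*q^14 + 34077161244045991287507914750*r*q^15
    + 126905182573197974156343970000*q^16)"
    unfolding r_def by algebra
  also have "\<dots> < 0"
    using assms by (intro mult_neg_pos add_nonneg_pos) (auto simp: r_def)
  finally show ?thesis .
qed

lemma Q_neg_below_approximate_root:
  assumes q: "0 < q" and pq: "59 * q \<le> p"
    and t: "p^2 \<le> t" "t \<le> p^2 + 2*p*q - 2*q^2"
  shows "Q p q t < 0"
proof -
  define a where "a = p^2 + 2*p*q - 2*q^2"
  have "0 < p"
    using q pq by linarith
  have "3481 * q^2 \<le> p^2"
    using power_mono[OF pq, of 2] q by (simp add: power_mult_distrib)
  moreover have "0 \<le> q^2"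
    by simp
  \<comment> \<open>These are the bounds under which the regroupings below show the coefficients
    nonnegative: the first and last serve \<open>c2\<close>, the second \<open>c3\<close>, the third
    \<open>c4\<close>.\<close>
  ultimately have sq: "49 * q^2 \<le> p^2" "6 * q^2 \<le> p^2" "q^2 \<le> 3 * p^2" "q^2 \<le> p^2"
    by linarith+
  have "q < p"
    using q pq by linarith
  then have "q * q < p * q"
    using q by simp
  then have "p^2 < a"
    by (simp add: a_def power2_eq_square)
  have "p^4 \<le> t^2"
    using power_mono[OF t(1), of 2] by simp
  have "t^2 \<le> a^2"
    using power_mono[OF t(2), of 2] order_trans[OF zero_le_power2 t(1)] by (simp add: a_def)
  have "p^4 < a^2"
    using power_strict_mono[OF \<open>p^2 < a\<close>, of 2] by simp
  have c0: "16*p^12*q^8 - 16*p^18*q^2 < 0"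
  proof -
    have "q^6 < p^6"
      using \<open>q < p\<close> q by (intro power_strict_mono) auto
    then have "(16*p^12*q^2) * (q^6 - p^6) < 0"
      using q \<open>0 < p\<close> by (intro mult_pos_neg) auto
    then show ?thesis
      by (simp add: algebra_simps flip: power_add)
  qed
  have c2: "0 \<le> p^12 - 49*p^10*q^2 + 38*p^8*q^4 + 26*p^6*q^6 + 17*p^4*q^8 - p^2*q^10"
  proof -
    \<comment> \<open>Each negative term is paired with a positive one: \<open>p^12\<close> absorbs
      the first, and one of the 17 copies of \<open>p^4*q^8\<close> absorbs the last.\<close>
    have "p^12 - 49*p^10*q^2 + 38*p^8*q^4 + 26*p^6*q^6 + 17*p^4*q^8 - p^2*q^10
        = p^10 * (p^2 - 49*q^2) + 38*p^8*q^4 + 26*p^6*q^6 + 16*p^4*q^8 + p^2*q^8 * (p^2 - q^2)"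
      by algebra
    also have "0 \<le> \<dots>"
      using sq by (intro add_nonneg_nonneg mult_nonneg_nonneg) simp_all
    finally show ?thesis .
  qed
  have c3: "0 \<le> 3*p^8 - 18*p^6*q^2 + 28*p^4*q^4 + 10*p^2*q^6 + q^8"
  proof -
    have "3*p^8 - 18*p^6*q^2 + 28*p^4*q^4 + 10*p^2*q^6 + q^8
        = 3*p^6 * (p^2 - 6*q^2) + 28*p^4*q^4 + 10*p^2*q^6 + q^8"
      by algebra
    also have "0 \<le> \<dots>"
      using sq by (intro add_nonneg_nonneg mult_nonneg_nonneg) simp_all
    finally show ?thesis .
  qed
  have c4: "0 \<le> 3*p^4 - p^2*q^2 + 6*q^4"
  proof -
    have "3*p^4 - p^2*q^2 + 6*q^4 = p^2 * (3*p^2 - q^2) + 6*q^4"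
      by algebra
    also have "0 \<le> \<dots>"
      using sq by (intro add_nonneg_nonneg mult_nonneg_nonneg) simp_all
    finally show ?thesis .
  qed
  have "Q p q a < 0"
    unfolding a_def using Q_neg_at_approximate_root q pq .
  show ?thesis
    unfolding Q_expansion[of p q t]
  proof (rule quintic_neg_between[OF _ _ _ c0 c2 c3 c4])
    show "0 \<le> t^2 - p^4" "t^2 - p^4 \<le> a^2 - p^4" "0 < a^2 - p^4"
      using \<open>p^4 \<le> t^2\<close> \<open>t^2 \<le> a^2\<close> \<open>p^4 < a^2\<close> by linarith+
  qed (use \<open>Q p q a < 0\<close> in \<open>simp_all only: Q_expansion[of p q a] zero_le_one\<close>)
qed

text \<open>The hypothesis on \<open>t\<close> says f(t) < 0 for f(t) = t^2 - (p^2 + p q) t - p^3 q.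
  This quadratic is already positive at the next integer \<open>b\<close> after the bound, and it
  increases from there on.\<close>

lemma cuboid_inequality_bound:
  fixes p q t :: int
  assumes q: "0 < q" and pq: "59 * q \<le> p" and cube: "9 * q^3 < p"
    and t: "2 * t^2 < (p^2 + t) * (p*q + t)"
  shows "t \<le> p^2 + 2*p*q - 2*q^2"
proof (rule ccontr)
  define b where "b = p^2 + 2*p*q - 2*q^2 + 1"
  assume "\<not> ?thesis"
  then have "b \<le> t"
    by (simp add: b_def)
  have "0 < p"
    using q pq by linarith
  have "(59 * q) * q \<le> p * q"
    using pq q by (intro mult_right_mono) auto
  then have qq: "59 * q^2 \<le> p * q"
    by (simp add: power2_eq_square)
  have "0 \<le> q^2" "0 \<le> p^2" "0 < p * q" "0 \<le> q^4"
    using q \<open>0 < p\<close> by auto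
  have "p * (9 * q^3) < p * p"
    using cube \<open>0 < p\<close> by simp
  then have cube': "9 * (p * q^3) < p^2"
    by (simp add: power2_eq_square)
  have "0 \<le> p * q^3"
    using q \<open>0 < p\<close> by simp
  \<comment> \<open>The summand 1 in \<open>b\<close> is what produces \<open>p^2\<close> here;
    without it the dominant term would be -6 p q^3. The bound p > 9 q^3 lets \<open>p^2\<close>
    outweigh that term.\<close>
  have "b^2 - b * (p^2 + p*q) - p^3*q
      = (p^2 - 6*(p*q^3)) + (3*(p*q) - 4*q^2) + 4*q^4 + 1"
    unfolding b_def by algebra
  then have "0 < b^2 - b * (p^2 + p*q) - p^3*q"
    using cube' \<open>0 \<le> p * q^3\<close> qq \<open>0 \<le> q^2\<close> \<open>0 \<le> q^4\<close> by linarith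
  \<comment> \<open>Monotonicity of f beyond \<open>b\<close>, through f(t) - f(b) = (t - b) (t + b
    - (p^2 + p q)).\<close>
  moreover have "p^2 + p*q \<le> t + b"
    using \<open>b \<le> t\<close> qq \<open>0 \<le> q^2\<close> \<open>0 \<le> p^2\<close> \<open>0 < p * q\<close>
    unfolding b_def mult.assoc by linarith
  then have "0 \<le> (t - b) * (t + b - (p^2 + p*q))"
    using \<open>b \<le> t\<close> by (intro mult_nonneg_nonneg) auto
  moreover have "(p^2 + t) * (p*q + t) - 2 * t^2
      = - (b^2 - b * (p^2 + p*q) - p^3*q) - (t - b) * (t + b - (p^2 + p*q))"
    by algebra
  ultimately show False
    using t by linarith
qed

theorem theorem8p5:
  fixes p q :: int
  assumes "p > 0" and "q > 0" and "coprime p q"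
    and "p \<ge> 59 * q" and "p > 9 * q^3"
  shows "\<not> (\<exists>t::int. Q p q t = 0 \<and> provides_perfect_cuboid p q t)"
proof
  assume "\<exists>t. Q p q t = 0 \<and> provides_perfect_cuboid p q t"
  then obtain t where "Q p q t = 0" "p^2 < t" "2 * t^2 < (p^2 + t) * (p*q + t)"
    by (auto simp: provides_perfect_cuboid_def)
  moreover from this have "t \<le> p^2 + 2*p*q - 2*q^2"
    using assms by (intro cuboid_inequality_bound) auto
  ultimately show False
    using Q_neg_below_approximate_root[of q p t] assms by simp
qed

end
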